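(* Let $P=[2]\times[n]$ with $n$ odd. For every rowmotion orbit $\mathcal{O}$ of $\mathcal{IC}(P)$ that contains a lower-chain singleton $\{(1,x)\}$ for some $1\le x\le n$, the average value $\frac1{|\mathcal{O}|}\sum_{I\in\mathcal{O}}\mathrm{sc}(I)$ is $0$.
   Context: $[2]\times[n]=\{(i,j): i\in\{1,2\},1\le j\le n\}$ with the componentwise order. An interval-closed set (ICS) is a subset $I$ with $x,y\in I$, $x\le z\le y\Rightarrow z\in I$; $\mathcal{IC}(P)$ is the set of ICS. The toggle $t_x$ sends $I$ to $I\triangle\{x\}$ if this is an ICS, and to $I$ otherwise; rowmotion is $\mathrm{Row}=t_{x_1}\circ\cdots\circ t_{x_N}$ for any linear extension $x_1,\dots,x_N$ (toggles applied top to bottom). The rank of $(i,j)$ is $i+j-2$; $\mathrm{sc}(x)=(-1)^{\mathrm{rank}(x)}$ and $\mathrm{sc}(I)=\sum_{x\in I}\mathrm{sc}(x)$. *)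

theory Defs
  imports Complex_Main "HOL-Library.Product_Order" "HOL-Combinatorics.Orbits"
begin

definition interval_closed :: "'a::order set \<Rightarrow> 'a set \<Rightarrow> bool" where
  "interval_closed P I \<longleftrightarrow>
     I \<subseteq> P \<and> (\<forall>x\<in>I. \<forall>y\<in>I. \<forall>z\<in>P. x \<le> z \<and> z \<le> y \<longrightarrow> z \<in> I)"

definition IC :: "'a::order set \<Rightarrow> 'a set set" where
  "IC P = {I. interval_closed P I}"

definition toggle :: "'a::order set \<Rightarrow> 'a \<Rightarrow> 'a set \<Rightarrow> 'a set" where
  "toggle P x I = (if sym_diff I {x} \<in> IC P then sym_diff I {x} else I)"

definition linear_extension :: "'a::order set \<Rightarrow> 'a list \<Rightarrow> bool" where
  "linear_extension P xs \<longleftrightarrow> distinct xs \<and> set xs = P \<and>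
     (\<forall>i<length xs. \<forall>j<length xs. xs ! i \<le> xs ! j \<longrightarrow> i \<le> j)"

(* foldr composes the toggles as t_{x_1} o ... o t_{x_N}, so the last (topmost) element
   of the linear extension is toggled first. *)
definition rowmotion :: "'a::order set \<Rightarrow> 'a list \<Rightarrow> 'a set \<Rightarrow> 'a set" where
  "rowmotion P xs = foldr (toggle P) xs"

(* The library's orbit f x is the forward orbit {f x, f (f x), ...}. For finite P, rowmotion
   permutes the finite set IC P (it is a composition of involutions), so this is the full
   orbit and contains x. *)
definition rowmotion_orbits :: "'a::order set \<Rightarrow> 'a list \<Rightarrow> 'a set set set" where
  "rowmotion_orbits P xs = {orbit (rowmotion P xs) I | I. I \<in> IC P}"

(* [2] x [n]; Product_Order supplies the componentwise order on pairs. *)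
definition two_by :: "nat \<Rightarrow> (nat \<times> nat) set" where
  "two_by n = {1..2} \<times> {1..n}"

(* The subtraction on nat is exact on [2] x [n], where both coordinates are at least 1. *)
definition grid_rank :: "nat \<times> nat \<Rightarrow> nat" where
  "grid_rank p = fst p + snd p - 2"

definition sc_elem :: "nat \<times> nat \<Rightarrow> int" where
  "sc_elem p = (-1) ^ grid_rank p"

definition sc :: "(nat \<times> nat) set \<Rightarrow> int" where
  "sc I = (\<Sum>p\<in>I. sc_elem p)"

end

theory Submission
  imports Defs
begin

text \<open>
  Write $[a,b]_1$ and $[c,d]_2$ for an interval in the lower, respectively upper, chain.
  Starting from $[a,b]_1$, rowmotion passes after $n-b+1$ steps through $[n-b+1,n-b+a]_2$, and a
  few steps later through an interval $[a',b']_1$ again. Summed over such a round, \<open>sc\<close> is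
  the increment of a potential depending on $[a,b]_1$ only, up to a correction that counts the
  visits to the singletons $\{(1,x)\}$ and $\{(2,x)\}$ with $x$ odd and $1<x<n$. Hence the sum over
  the orbit is the number of upper singletons of this kind in the orbit minus the number of lower
  ones. Following the singletons explicitly, $\{(1,x)\}$ leads to $\{(2,x+3)\}$ and $\{(2,x)\}$ to
  $\{(1,x+3)\}$, apart from a few exceptions near $x=n$; these relations force the number of upper
  minus the number of lower singletons at $x$ to be opposite to the one at $n+1-x$.
\<close>

section \<open>Toggles and rowmotion\<close>

lemma toggle_in_IC: "I \<in> IC P \<Longrightarrow> toggle P x I \<in> IC P"
  by (simp add: toggle_def)

lemma rowmotion_in_IC: "I \<in> IC P \<Longrightarrow> rowmotion P xs I \<in> IC P"
  unfolding rowmotion_def by (induction xs) (auto intro: toggle_in_IC)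

lemma toggle_toggle: "I \<in> IC P \<Longrightarrow> toggle P x (toggle P x I) = I"
proof -
  have "sym_diff (sym_diff I {x}) {x} = I" by auto
  then show "I \<in> IC P \<Longrightarrow> toggle P x (toggle P x I) = I"
    by (auto simp: toggle_def)
qed

lemma inj_on_rowmotion: "inj_on (rowmotion P xs) (IC P)"
proof (induction xs)
  case Nil
  then show ?case by (simp add: rowmotion_def)
next
  case (Cons x xs)
  have "inj_on (toggle P x) (IC P)"
    by (metis inj_onI toggle_toggle)
  then have "inj_on (toggle P x \<circ> rowmotion P xs) (IC P)"
    using Cons rowmotion_in_IC by (intro comp_inj_on) (auto intro: inj_on_subset)
  then show ?case by (simp add: rowmotion_def comp_def)
qed

section \<open>Interval-closed sets and the effect of a single toggle\<close>

lemma IC_between: "K \<in> IC P \<Longrightarrow> a \<in> K \<Longrightarrow> b \<in> K \<Longrightarrow> z \<in> P \<Longrightarrow> a \<le> z \<Longrightarrow> z \<le> b \<Longrightarrow> z \<in> K"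
  unfolding IC_def interval_closed_def by blast

lemma IC_subset: "K \<in> IC P \<Longrightarrow> K \<subseteq> P"
  by (simp add: IC_def interval_closed_def)

lemma IC_I:
  assumes "K \<subseteq> P" "\<And>a b z. a \<in> K \<Longrightarrow> b \<in> K \<Longrightarrow> z \<in> P \<Longrightarrow> a < z \<Longrightarrow> z < b \<Longrightarrow> z \<in> K"
  shows "K \<in> IC P"
  unfolding IC_def interval_closed_def mem_Collect_eq
proof (intro conjI ballI impI)
  fix a b z assume "a \<in> K" "b \<in> K" "z \<in> P" "a \<le> z \<and> z \<le> b"
  then show "z \<in> K" using assms(2)[of a b z] by (cases "a = z"; cases "z = b") (simp_all add: less_le)
qed (rule assms(1))

text \<open>Removing \<open>x\<close> leaves all other required elements in place, so closure can
  fail only by \<open>x\<close> itself lying strictly between two remaining elements.\<close>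

lemma toggle_member:
  assumes K: "K \<in> IC P" "x \<in> P" "x \<in> K"
  shows "toggle P x K = (if (\<exists>a\<in>K. a < x) \<and> (\<exists>b\<in>K. x < b) then K else K - {x})"
proof -
  have eq: "sym_diff K {x} = K - {x}" using assms by auto
  have "K - {x} \<in> IC P \<longleftrightarrow> \<not> ((\<exists>a\<in>K. a < x) \<and> (\<exists>b\<in>K. x < b))"
  proof
    assume Kx: "K - {x} \<in> IC P"
    have False if "a \<in> K" "a < x" "b \<in> K" "x < b" for a b
      using IC_between[OF Kx, of a b x] that K(2) by (auto simp: less_le)
    then show "\<not> ((\<exists>a\<in>K. a < x) \<and> (\<exists>b\<in>K. x < b))" by blast
  next
    assume *: "\<not> ((\<exists>a\<in>K. a < x) \<and> (\<exists>b\<in>K. x < b))"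
    show "K - {x} \<in> IC P"
    proof (rule IC_I)
      show "K - {x} \<subseteq> P" using IC_subset[OF K(1)] by blast
      fix a b z assume abz: "a \<in> K - {x}" "b \<in> K - {x}" "z \<in> P" "a < z" "z < b"
      then have "z \<in> K" using IC_between[OF K(1), of a b z] by (auto simp: less_le)
      moreover have "z \<noteq> x" using * abz by blast
      ultimately show "z \<in> K - {x}" by blast
    qed
  qed
  then show ?thesis unfolding toggle_def eq by presburger
qed

text \<open>Inserting \<open>x\<close> creates new order intervals only with \<open>x\<close> as an
  endpoint. The two conjuncts treat \<open>x\<close> as the lower and as the upper endpoint.\<close>

lemma toggle_nonmember:
  assumes K: "K \<in> IC P" "x \<in> P" "x \<notin> K"
  shows "toggle P x K =
    (if (\<forall>b\<in>K. \<forall>z\<in>P. x < z \<and> z < b \<longrightarrow> z \<in> K) \<and> (\<forall>a\<in>K. \<forall>z\<in>P. a < z \<and> z < x \<longrightarrow> z \<in> K)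
     then insert x K else K)"
proof -
  have eq: "sym_diff K {x} = insert x K" using assms by auto
  have "insert x K \<in> IC P \<longleftrightarrow> (\<forall>b\<in>K. \<forall>z\<in>P. x < z \<and> z < b \<longrightarrow> z \<in> K) \<and>
          (\<forall>a\<in>K. \<forall>z\<in>P. a < z \<and> z < x \<longrightarrow> z \<in> K)" (is "_ \<longleftrightarrow> ?R")
  proof
    assume *: "insert x K \<in> IC P"
    have "z \<in> K" if "b \<in> K" "z \<in> P" "x < z" "z < b" for b z
      using IC_between[OF *, of x b z] that by (auto simp: less_le)
    moreover have "z \<in> K" if "a \<in> K" "z \<in> P" "a < z" "z < x" for a z
      using IC_between[OF *, of a x z] that by (auto simp: less_le)
    ultimately show ?R by blast
  next
    assume R: ?R
    show "insert x K \<in> IC P"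
    proof (rule IC_I)
      show "insert x K \<subseteq> P" using IC_subset[OF K(1)] K(2) by blast
      fix a b z assume abz: "a \<in> insert x K" "b \<in> insert x K" "z \<in> P" "a < z" "z < b"
      then consider "a = x" "b \<in> K" | "a \<in> K" "b = x" | "a \<in> K" "b \<in> K"
        by (auto dest: less_trans)
      then show "z \<in> insert x K"
      proof cases
        case 3
        then show ?thesis using IC_between[OF K(1), of a b z] abz by (auto simp: less_le)
      qed (use R abz in blast)+
    qed
  qed
  then show ?thesis by (simp only: toggle_def eq)
qed

text \<open>When \<open>x\<close> is toggled, everything above it already agrees with the result \<open>J\<close>,
  while everything below it still agrees with \<open>I\<close>; elements incomparable to \<open>x\<close> are irrelevant.\<close>

lemma rowmotion_eqI:
  assumes lin: "linear_extension P xs" and I: "I \<in> IC P" and J: "J \<subseteq> P"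
    and mem: "\<And>x. x \<in> P \<Longrightarrow> x \<in> I \<Longrightarrow> x \<in> J \<longleftrightarrow> (\<exists>a\<in>I. a < x) \<and> (\<exists>b\<in>J. x < b)"
    and nonmem: "\<And>x. x \<in> P \<Longrightarrow> x \<notin> I \<Longrightarrow> x \<in> J \<longleftrightarrow>
      (\<forall>b\<in>J. \<forall>z\<in>P. x < z \<and> z < b \<longrightarrow> z \<in> J) \<and> (\<forall>a\<in>I. \<forall>z\<in>P. a < z \<and> z < x \<longrightarrow> z \<in> I)"
  shows "rowmotion P xs I = J"
proof -
  have P: "set xs = P" and IP: "I \<subseteq> P"
    using lin I by (auto simp: linear_extension_def IC_def interval_closed_def)
  \<comment> \<open>Induction over suffixes of \<open>xs\<close>, because \<open>foldr\<close>
    applies the toggles at the end of the list first. After the suffix \<open>ys\<close> the current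
    set is \<open>J\<close> on \<open>ys\<close> and still \<open>I\<close> elsewhere.\<close>
  have "xs = zs @ ys \<Longrightarrow> rowmotion P ys I = (J \<inter> set ys) \<union> (I - set ys)" for zs ys
  proof (induction ys arbitrary: zs)
    case Nil
    then show ?case by (simp add: rowmotion_def)
  next
    case (Cons x ys)
    define K where "K = (J \<inter> set ys) \<union> (I - set ys)"
    have IH: "rowmotion P ys I = K"
      unfolding K_def using Cons.IH[of "zs @ [x]"] Cons.prems by simp
    have K: "K \<in> IC P" using IH rowmotion_in_IC[OF I, of ys] by simp
    have KP: "K \<subseteq> P" using K by (simp add: IC_def interval_closed_def)
    have x: "x \<in> P" "x \<notin> set ys" using Cons.prems lin P by (auto simp: linear_extension_def)
    have nth_x: "xs ! length zs = x" "length zs < length xs" using Cons.prems by auto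
    have above: "y \<in> set ys" if y: "y \<in> P" "x < y" for y
    proof -
      obtain j where j: "j < length xs" "xs ! j = y" using y P by (metis in_set_conv_nth)
      have "length zs \<le> j" using lin j nth_x y unfolding linear_extension_def by (metis less_le)
      moreover have "length zs \<noteq> j" using nth_x j y by auto
      ultimately have "j = length zs + Suc (j - length zs - 1)" by simp
      then have "y = ys ! (j - length zs - 1)" "j - length zs - 1 < length ys"
        using j Cons.prems by (metis nth_append_length_plus nth_Cons_Suc, simp)
      then show ?thesis by simp
    qed
    have below: "y \<notin> set ys" if y: "y < x" for y
    proof
      assume "y \<in> set ys"
      then obtain i where i: "i < length ys" "ys ! i = y" by (metis in_set_conv_nth)
      have "xs ! (length zs + Suc i) = y" "length zs + Suc i < length xs"
        using i Cons.prems by (metis nth_append_length_plus nth_Cons_Suc, simp)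
      then show False
        using lin nth_x y unfolding linear_extension_def by (metis less_le not_add_less1 not_less not_less_eq_eq
            add_Suc_right le_add1)
    qed
    have Ka: "y \<in> K \<longleftrightarrow> y \<in> J" if "x < y" "y \<in> P" for y
      using above[OF that(2,1)] by (simp add: K_def)
    have Kb: "y \<in> K \<longleftrightarrow> y \<in> I" if "y < x" for y
      using below[OF that] by (simp add: K_def)
    have Kx: "x \<in> K \<longleftrightarrow> x \<in> I" using x by (simp add: K_def)
    have "toggle P x K = (J \<inter> set (x # ys)) \<union> (I - set (x # ys))"
    proof (cases "x \<in> I")
      case True
      have "(\<exists>a\<in>K. a < x) \<and> (\<exists>b\<in>K. x < b) \<longleftrightarrow> x \<in> J"
        using mem[OF x(1) True] Ka Kb KP J by blast
      then show ?thesis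
        using toggle_member[OF K x(1)] Kx True x by (auto simp: K_def)
    next
      case False
      have "(\<forall>b\<in>K. \<forall>z\<in>P. x < z \<and> z < b \<longrightarrow> z \<in> K) \<longleftrightarrow> (\<forall>b\<in>J. \<forall>z\<in>P. x < z \<and> z < b \<longrightarrow> z \<in> J)"
        using Ka KP J by (meson less_trans subsetD)
      moreover have "(\<forall>a\<in>K. \<forall>z\<in>P. a < z \<and> z < x \<longrightarrow> z \<in> K) \<longleftrightarrow> (\<forall>a\<in>I. \<forall>z\<in>P. a < z \<and> z < x \<longrightarrow> z \<in> I)"
        using Kb by (meson less_trans)
      ultimately show ?thesis
        using toggle_nonmember[OF K x(1)] nonmem[OF x(1) False] Kx False x by (auto simp: K_def)
    qed
    then show ?case using IH by (simp add: rowmotion_def)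
  qed
  from this[of "[]" xs] show ?thesis using P J IP by auto
qed

section \<open>Rowmotion on two chains\<close>

text \<open>An empty lower or upper part is represented below by the bounds \<open>1 0\<close>.\<close>

definition rows :: "nat \<Rightarrow> nat \<Rightarrow> nat \<Rightarrow> nat \<Rightarrow> (nat \<times> nat) set" where
  "rows a b c d = {1} \<times> {a..b} \<union> {2} \<times> {c..d}"

lemma mem_rows [simp]: "(i, j) \<in> rows a b c d \<longleftrightarrow> i = 1 \<and> a \<le> j \<and> j \<le> b \<or> i = 2 \<and> c \<le> j \<and> j \<le> d"
  by (auto simp: rows_def)

text \<open>The chains are comparable only upwards, from \<open>(1, j)\<close> to
  \<open>(2, k)\<close> with \<open>j \<le> k\<close>. If both parts are nonempty and
  \<open>a \<le> d\<close>, the order interval from \<open>(1, a)\<close> to \<open>(2, d)\<close>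
  contains \<open>(2, a)\<close> and \<open>(1, d)\<close>, whence the last assumption.\<close>

lemma rows_in_IC:
  assumes "1 \<le> a" "b \<le> n" "1 \<le> c" "d \<le> n" "a \<le> b \<Longrightarrow> a \<le> d \<Longrightarrow> c \<le> d \<Longrightarrow> c \<le> a \<and> d \<le> b"
  shows "rows a b c d \<in> IC (two_by n)"
  unfolding IC_def interval_closed_def mem_Collect_eq
proof (intro conjI ballI impI)
  show "rows a b c d \<subseteq> two_by n" using assms by (auto simp: rows_def two_by_def)
  fix x y z assume xyz: "x \<in> rows a b c d" "y \<in> rows a b c d" "z \<in> two_by n" "x \<le> z \<and> z \<le> y"
  obtain x1 x2 y1 y2 z1 z2 where "x = (x1,x2)" "y = (y1,y2)" "z = (z1,z2)" by (metis surj_pair)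
  with xyz assms show "z \<in> rows a b c d"
    by (auto simp: two_by_def le_Suc_eq)
qed

lemma less_pair_iff: "(i, j) < (k, l) \<longleftrightarrow> (i < k \<and> j \<le> l) \<or> (i \<le> k \<and> j < (l::nat))" for i :: nat
  by (auto simp: less_le)

lemma two_by_cases:
  assumes "x \<in> two_by n"
  obtains j where "x = (1, j)" "1 \<le> j" "j \<le> n" | j where "x = (2, j)" "1 \<le> j" "j \<le> n"
proof -
  obtain i j where x: "x = (i, j)" by fastforce
  have "i = 1 \<or> i = 2" "1 \<le> j" "j \<le> n" using assms x by (auto simp: two_by_def)
  then show thesis using x that by blast
qed

lemma rows_cases:
  assumes "p \<in> rows a b c d"
  obtains j where "p = (1, j)" "a \<le> j" "j \<le> b" | j where "p = (2, j)" "c \<le> j" "j \<le> d"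
  using assms by (auto simp: rows_def)

section \<open>Toggle conditions on two chains as inequalities between bounds\<close>

lemma Bex_rows: "(\<exists>p\<in>rows a b c d. Q p) \<longleftrightarrow> (\<exists>j\<in>{a..b}. Q (1, j)) \<or> (\<exists>j\<in>{c..d}. Q (2, j))"
  by (auto simp: rows_def)

text \<open>Only the top elements \<open>(1, b')\<close> and \<open>(2, d')\<close> of the two parts
  need testing, and against them only the intermediate points \<open>(1, j + 1)\<close>,
  \<open>(1, d')\<close> and \<open>(2, j)\<close>. This and the next three lemmas make the
  conditions of \<open>rowmotion_eqI\<close> accessible to linear arithmetic.\<close>

lemma between_above_row1:
  assumes "1 \<le> a'" "b' \<le> n" "1 \<le> c'" "d' \<le> n" "1 \<le> j" "j \<le> n"
  shows "(\<forall>q\<in>rows a' b' c' d'. \<forall>z\<in>two_by n. (1, j) < z \<and> z < q \<longrightarrow> z \<in> rows a' b' c' d') \<longleftrightarrow>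
    (a' \<le> b' \<and> j < b' \<longrightarrow> a' \<le> j + 1) \<and>
    (c' \<le> d' \<and> j \<le> d' \<longrightarrow> c' \<le> j \<and> (j < d' \<longrightarrow> a' \<le> j + 1 \<and> d' \<le> b'))" (is "?L \<longleftrightarrow> ?R")
proof
  assume L: ?L
  have L0: "a' \<le> z \<and> z \<le> b'" if "a' \<le> k" "k \<le> b'" "j < z" "z < k" for k z
    using L[rule_format, of "(1, k)" "(1, z)"] that assms by (simp add: less_pair_iff two_by_def)
  have L1: "a' \<le> z \<and> z \<le> b'" if "c' \<le> k" "k \<le> d'" "j < z" "z \<le> k" for k z
    using L[rule_format, of "(2, k)" "(1, z)"] that assms by (simp add: less_pair_iff two_by_def)
  have L2: "c' \<le> z \<and> z \<le> d'" if "c' \<le> k" "k \<le> d'" "j \<le> z" "z < k" for k z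
    using L[rule_format, of "(2, k)" "(2, z)"] that assms by (simp add: less_pair_iff two_by_def)
  show ?R
    using L0[of b' "j+1"] L1[of d' "j+1"] L1[of d' d'] L2[of d' j] by force
next
  assume R: ?R
  have "z \<in> rows a' b' c' d'" if p: "p \<in> rows a' b' c' d'" and z: "z \<in> two_by n"
      and o: "(1, j) < z" "z < p" for p z
  proof -
    obtain k l where "z = (k, l)" "k = 1 \<or> k = 2"
      using z by (auto elim: two_by_cases)
    from p show ?thesis
    proof (cases rule: rows_cases)
      case (1 m)
      have "j < b'" using 1 o \<open>z = (k, l)\<close> by (auto simp: less_pair_iff)
      then have "a' \<le> j + 1" using R 1 by auto
      with 1 o \<open>z = (k, l)\<close> \<open>k = 1 \<or> k = 2\<close> show ?thesis
        by (elim disjE) (auto simp: less_pair_iff)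
    next
      case (2 m)
      have "j \<le> d'" using 2 o \<open>z = (k, l)\<close> by (auto simp: less_pair_iff)
      then have "c' \<le> j" "j < d' \<longrightarrow> a' \<le> j + 1 \<and> d' \<le> b'" using R 2 by auto
      with 2 o \<open>z = (k, l)\<close> \<open>k = 1 \<or> k = 2\<close> show ?thesis
        by (elim disjE) (auto simp: less_pair_iff)
    qed
  qed
  then show ?L by blast
qed

lemma between_above_row2:
  assumes "1 \<le> a'" "b' \<le> n" "1 \<le> c'" "d' \<le> n" "1 \<le> j" "j \<le> n"
  shows "(\<forall>q\<in>rows a' b' c' d'. \<forall>z\<in>two_by n. (2, j) < z \<and> z < q \<longrightarrow> z \<in> rows a' b' c' d') \<longleftrightarrow>
    (c' \<le> d' \<and> j < d' \<longrightarrow> c' \<le> j + 1)" (is "?L \<longleftrightarrow> ?R")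
proof
  assume L: ?L
  have L0: "c' \<le> z \<and> z \<le> d'" if "c' \<le> k" "k \<le> d'" "j < z" "z < k" for k z
    using L[rule_format, of "(2, k)" "(2, z)"] that assms by (simp add: less_pair_iff two_by_def)
  show ?R
    using L0[of d' "j+1"] by force
next
  assume R: ?R
  have "z \<in> rows a' b' c' d'" if p: "p \<in> rows a' b' c' d'" and z: "z \<in> two_by n"
      and o: "(2, j) < z" "z < p" for p z
  proof -
    obtain k l where "z = (k, l)" "k = 1 \<or> k = 2"
      using z by (auto elim: two_by_cases)
    with p o R assms show ?thesis
      by (elim rows_cases) (auto simp: less_pair_iff)
  qed
  then show ?L by blast
qed

lemma between_below_row1:
  assumes "1 \<le> a" "b \<le> n" "1 \<le> c" "d \<le> n" "1 \<le> j" "j \<le> n"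
  shows "(\<forall>p\<in>rows a b c d. \<forall>z\<in>two_by n. p < z \<and> z < (1, j) \<longrightarrow> z \<in> rows a b c d) \<longleftrightarrow>
    (a \<le> b \<and> a < j \<longrightarrow> j \<le> b + 1)" (is "?L \<longleftrightarrow> ?R")
proof
  assume L: ?L
  have L0: "a \<le> z \<and> z \<le> b" if "a \<le> k" "k \<le> b" "k < z" "z < j" for k z
    using L[rule_format, of "(1, k)" "(1, z)"] that assms by (simp add: less_pair_iff two_by_def)
  show ?R
    using L0[of b "b+1"] by force
next
  assume R: ?R
  have "z \<in> rows a b c d" if p: "p \<in> rows a b c d" and z: "z \<in> two_by n"
      and o: "p < z" "z < (1, j)" for p z
  proof -
    obtain k l where "z = (k, l)" "k = 1 \<or> k = 2"
      using z by (auto elim: two_by_cases)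
    with p o R assms show ?thesis
      by (elim rows_cases) (auto simp: less_pair_iff)
  qed
  then show ?L by blast
qed

lemma between_below_row2:
  assumes "1 \<le> a" "b \<le> n" "1 \<le> c" "d \<le> n" "1 \<le> j" "j \<le> n"
  shows "(\<forall>p\<in>rows a b c d. \<forall>z\<in>two_by n. p < z \<and> z < (2, j) \<longrightarrow> z \<in> rows a b c d) \<longleftrightarrow>
    (c \<le> d \<and> c < j \<longrightarrow> j \<le> d + 1) \<and>
    (a \<le> b \<and> a \<le> j \<longrightarrow> j \<le> b \<and> (a < j \<longrightarrow> c \<le> a \<and> j \<le> d + 1))" (is "?L \<longleftrightarrow> ?R")
proof
  assume L: ?L
  have L0: "c \<le> z \<and> z \<le> d" if "c \<le> k" "k \<le> d" "k < z" "z < j" for k z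
    using L[rule_format, of "(2, k)" "(2, z)"] that assms by (simp add: less_pair_iff two_by_def)
  have L1: "a \<le> z \<and> z \<le> b" if "a \<le> k" "k \<le> b" "k < z" "z \<le> j" for k z
    using L[rule_format, of "(1, k)" "(1, z)"] that assms by (simp add: less_pair_iff two_by_def)
  have L2: "c \<le> z \<and> z \<le> d" if "a \<le> k" "k \<le> b" "k \<le> z" "z < j" for k z
    using L[rule_format, of "(1, k)" "(2, z)"] that assms by (simp add: less_pair_iff two_by_def)
  show ?R
    using L0[of d "d+1"] L1[of a j] L2[of a a] L2[of a "j-1"] by force
next
  assume R: ?R
  have "z \<in> rows a b c d" if p: "p \<in> rows a b c d" and z: "z \<in> two_by n"
      and o: "p < z" "z < (2, j)" for p z
  proof -
    obtain k l where "z = (k, l)" "k = 1 \<or> k = 2"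
      using z by (auto elim: two_by_cases)
    from p show ?thesis
    proof (cases rule: rows_cases)
      case (1 m)
      have "a \<le> j" using 1 o \<open>z = (k, l)\<close> by (auto simp: less_pair_iff)
      then have "j \<le> b" "a < j \<longrightarrow> c \<le> a \<and> j \<le> d + 1" using R 1 by auto
      with 1 o \<open>z = (k, l)\<close> \<open>k = 1 \<or> k = 2\<close> show ?thesis
        by (elim disjE) (auto simp: less_pair_iff)
    next
      case (2 m)
      have "c < j" using 2 o \<open>z = (k, l)\<close> by (auto simp: less_pair_iff)
      then have "j \<le> d + 1" using R 2 by auto
      with 2 o \<open>z = (k, l)\<close> \<open>k = 1 \<or> k = 2\<close> show ?thesis
        by (elim disjE) (auto simp: less_pair_iff)
    qed
  qed
  then show ?L by blast
qed

text \<open>The image is guessed, not computed: \<open>row1\<close> and \<open>row2\<close> mention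
  the new bounds on both sides, as \<open>rowmotion_eqI\<close> does with \<open>J\<close>. Each
  transition rule below then amounts to arithmetic in a single position \<open>j\<close>.\<close>

lemma rowmotion_rows:
  assumes lin: "linear_extension (two_by n) xs"
    and I: "1 \<le> a" "b \<le> n" "1 \<le> c" "d \<le> n" "a \<le> b \<Longrightarrow> a \<le> d \<Longrightarrow> c \<le> d \<Longrightarrow> c \<le> a \<and> d \<le> b"
    and J: "1 \<le> a'" "b' \<le> n" "1 \<le> c'" "d' \<le> n"
    and row1: "\<And>j. 1 \<le> j \<Longrightarrow> j \<le> n \<Longrightarrow> (a' \<le> j \<and> j \<le> b') \<longleftrightarrow>
      (if a \<le> j \<and> j \<le> b then a < j \<and> (a' \<le> b' \<and> j < b' \<or> c' \<le> d' \<and> j \<le> d')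
       else (a' \<le> b' \<and> j < b' \<longrightarrow> a' \<le> j + 1) \<and>
            (c' \<le> d' \<and> j \<le> d' \<longrightarrow> c' \<le> j \<and> (j < d' \<longrightarrow> a' \<le> j + 1 \<and> d' \<le> b')) \<and>
            (a \<le> b \<and> a < j \<longrightarrow> j \<le> b + 1))"
    and row2: "\<And>j. 1 \<le> j \<Longrightarrow> j \<le> n \<Longrightarrow> (c' \<le> j \<and> j \<le> d') \<longleftrightarrow>
      (if c \<le> j \<and> j \<le> d then (c < j \<or> a \<le> b \<and> a \<le> j) \<and> j < d'
       else (c' \<le> d' \<and> j < d' \<longrightarrow> c' \<le> j + 1) \<and>
            (c \<le> d \<and> c < j \<longrightarrow> j \<le> d + 1) \<and>
            (a \<le> b \<and> a \<le> j \<longrightarrow> j \<le> b \<and> (a < j \<longrightarrow> c \<le> a \<and> j \<le> d + 1)))"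
  shows "rowmotion (two_by n) xs (rows a b c d) = rows a' b' c' d'"
proof (rule rowmotion_eqI[OF lin])
  show "rows a b c d \<in> IC (two_by n)" using I by (rule rows_in_IC)
  show "rows a' b' c' d' \<subseteq> two_by n" using J by (auto simp: rows_def two_by_def)
next
  fix x assume x: "x \<in> two_by n" "x \<in> rows a b c d"
  from x(1) show "x \<in> rows a' b' c' d' \<longleftrightarrow> (\<exists>p\<in>rows a b c d. p < x) \<and> (\<exists>q\<in>rows a' b' c' d'. x < q)"
  proof (cases rule: two_by_cases)
    case (1 j)
    then have j: "a \<le> j" "j \<le> b" using x by auto
    have "(\<exists>p\<in>rows a b c d. p < x) \<longleftrightarrow> a < j"
      using j by (auto simp: 1 Bex_rows less_pair_iff)
    moreover have "(\<exists>q\<in>rows a' b' c' d'. x < q) \<longleftrightarrow> a' \<le> b' \<and> j < b' \<or> c' \<le> d' \<and> j \<le> d'"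
      by (auto simp: 1 Bex_rows less_pair_iff)
    ultimately show ?thesis using row1[OF 1(2,3)] j by (simp add: 1)
  next
    case (2 j)
    then have j: "c \<le> j" "j \<le> d" using x by auto
    have "(\<exists>p\<in>rows a b c d. p < x) \<longleftrightarrow> c < j \<or> a \<le> b \<and> a \<le> j"
      using j by (auto simp: 2 Bex_rows less_pair_iff)
    moreover have "(\<exists>q\<in>rows a' b' c' d'. x < q) \<longleftrightarrow> c' \<le> d' \<and> j < d'"
      by (auto simp: 2 Bex_rows less_pair_iff)
    ultimately show ?thesis using row2[OF 2(2,3)] j by (auto simp add: 2)
  qed
next
  fix x assume x: "x \<in> two_by n" "x \<notin> rows a b c d"
  from x(1) show "x \<in> rows a' b' c' d' \<longleftrightarrow>
      (\<forall>q\<in>rows a' b' c' d'. \<forall>z\<in>two_by n. x < z \<and> z < q \<longrightarrow> z \<in> rows a' b' c' d') \<and>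
      (\<forall>p\<in>rows a b c d. \<forall>z\<in>two_by n. p < z \<and> z < x \<longrightarrow> z \<in> rows a b c d)"
  proof (cases rule: two_by_cases)
    case (1 j)
    then have "\<not> (a \<le> j \<and> j \<le> b)" using x by auto
    from row1[OF 1(2,3), unfolded if_not_P[OF this]] show ?thesis
      unfolding 1(1) between_above_row1[OF J 1(2,3)] between_below_row1[OF I(1-4) 1(2,3)] mem_rows by simp
  next
    case (2 j)
    then have "\<not> (c \<le> j \<and> j \<le> d)" using x by auto
    from row2[OF 2(2,3), unfolded if_not_P[OF this]] show ?thesis
      unfolding 2(1) between_above_row2[OF J 2(2,3)] between_below_row2[OF I(1-4) 2(2,3)] mem_rows by simp
  qed
qed

section \<open>Explicit rowmotion steps\<close>

locale two_row =
  fixes n :: nat and xs :: "(nat \<times> nat) list"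
  assumes lin: "linear_extension (two_by n) xs"
begin

abbreviation "row \<equiv> rowmotion (two_by n) xs"

text \<open>The rules follow the course of a round: a lower interval climbs with a second interval
  below it in the upper chain (\<open>row_shift\<close>), vanishes at the top, and is rebuilt
  through \<open>row_top\<close>, \<open>row_mid\<close> and \<open>row_prefix\<close>. The
  \<open>_end\<close> rules apply where an interval has reached \<open>n\<close>, the
  \<open>_full\<close> rules where a whole chain is occupied.\<close>

lemma row_bottom_start:
  assumes "1 \<le> a" "a \<le> b" "b < n"
  shows "row (rows a b 1 0) = rows (a+1) (b+1) 1 a"
  by (rule rowmotion_rows[OF lin]) (use assms in auto)

lemma row_bottom_end:
  assumes "1 \<le> a" "a \<le> n"
  shows "row (rows a n 1 0) = rows 1 0 1 a"
  by (rule rowmotion_rows[OF lin]) (use assms in auto)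

lemma row_shift:
  assumes "1 \<le> c" "c < a" "a \<le> b" "b < n"
  shows "row (rows a b c (a-1)) = rows (a+1) (b+1) (c+1) a"
  by (rule rowmotion_rows[OF lin]) (use assms in auto)

lemma row_shift_end:
  assumes "1 \<le> c" "c < a" "a \<le> n"
  shows "row (rows a n c (a-1)) = rows 1 0 (c+1) a"
  by (rule rowmotion_rows[OF lin]) (use assms in auto)

lemma row_top:
  assumes "1 \<le> c" "c \<le> d" "d < n"
  shows "row (rows 1 0 c d) = rows (c+1) n (c+1) (d+1)"
  by (rule rowmotion_rows[OF lin]) (use assms in auto)

lemma row_top_end:
  assumes "2 \<le> c" "c \<le> n"
  shows "row (rows 1 0 c n) = rows 1 n 1 (c-1)"
  by (rule rowmotion_rows[OF lin]) (use assms in auto)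

lemma row_top_full:
  assumes "1 \<le> n"
  shows "row (rows 1 0 1 n) = rows 1 n 1 0"
  by (rule rowmotion_rows[OF lin]) (use assms in auto)

lemma row_mid:
  assumes "2 \<le> c" "c \<le> d" "d < n"
  shows "row (rows c n c d) = rows (c+1) (d+1) 1 (d+1)"
  by (rule rowmotion_rows[OF lin]) (use assms in auto)

lemma row_mid_end:
  assumes "2 \<le> c" "c \<le> n"
  shows "row (rows c n c n) = rows 1 (c-1) 1 (c-1)"
  by (rule rowmotion_rows[OF lin]) (use assms in auto)

lemma row_mid_full:
  assumes "1 \<le> c" "c < n"
  shows "row (rows 1 n 1 c) = rows 2 (c+1) 1 (c+1)"
  by (rule rowmotion_rows[OF lin]) (use assms in auto)

lemma row_prefix:
  assumes "1 \<le> c" "c \<le> d" "d < n"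
  shows "row (rows c d 1 d) = rows (c+1) (d+1) 1 0"
  by (rule rowmotion_rows[OF lin]) (use assms in auto)

lemma row_prefix_end:
  assumes "2 \<le> c" "c \<le> n"
  shows "row (rows c n 1 n) = rows 1 (c-1) 1 0"
  by (rule rowmotion_rows[OF lin]) (use assms in auto)

end

section \<open>The signed cardinality along a round\<close>

text \<open>Closed form of the sum of \<open>(-1) ^ j\<close> over \<open>{a..b}\<close>: neighbours
  cancel, and one term survives exactly when the number of terms is odd.\<close>

definition alt_sum :: "nat \<Rightarrow> nat \<Rightarrow> int" where
  "alt_sum a b = (if a \<le> b \<and> even (a + b) then if even a then 1 else -1 else 0)"

lemma sum_alternating: "(\<Sum>j\<in>{a..b}. (-1::int) ^ j) = alt_sum a b"
proof (induction b)
  case 0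
  then show ?case by (cases a) (auto simp: alt_sum_def)
next
  case (Suc b)
  show ?case
  proof (cases "a \<le> Suc b")
    case True
    then have "(\<Sum>j\<in>{a..Suc b}. (-1::int) ^ j) = alt_sum a b + (-1) ^ Suc b"
      by (simp add: Suc.IH)
    also have "\<dots> = alt_sum a (Suc b)"
      using True by (cases "a = Suc b") (auto simp: alt_sum_def)
    finally show ?thesis .
  qed (simp add: alt_sum_def)
qed

lemma alt_sum_Suc_Suc: "alt_sum (Suc a) (Suc b) = - alt_sum a b"
  by (auto simp: alt_sum_def)

text \<open>The rank of \<open>(1, j)\<close> is \<open>j - 1\<close> and that of
  \<open>(2, j)\<close> is \<open>j\<close>, so the lower chain contributes with the opposite
  sign.\<close>

lemma sc_rows: "1 \<le> a \<Longrightarrow> sc (rows a b c d) = alt_sum c d - alt_sum a b"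
proof -
  assume a: "1 \<le> a"
  have "sc (rows a b c d) = (\<Sum>p\<in>{1} \<times> {a..b}. sc_elem p) + (\<Sum>p\<in>{2} \<times> {c..d}. sc_elem p)"
    unfolding sc_def rows_def by (rule sum.union_disjoint) auto
  also have "(\<Sum>p\<in>{1::nat} \<times> {a..b}. sc_elem p) = (\<Sum>j\<in>{a..b}. sc_elem (1, j))"
    by (simp add: sum.cartesian_product' del: One_nat_def)
  also have "\<dots> = (\<Sum>j\<in>{a..b}. - ((-1) ^ j))"
  proof (rule sum.cong)
    fix j assume "j \<in> {a..b}"
    \<comment> \<open>At \<open>j = 0\<close> the truncated subtraction in \<open>grid_rank\<close>
      would give the wrong sign; \<open>1 \<le> a\<close> excludes it.\<close>
    then obtain i where "j = Suc i" using a by (cases j) auto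
    then show "sc_elem (1, j) = - ((-1) ^ j)" by (simp add: sc_elem_def grid_rank_def)
  qed simp
  also have "(\<Sum>p\<in>{2::nat} \<times> {c..d}. sc_elem p) = (\<Sum>j\<in>{c..d}. (-1) ^ j)"
    by (simp add: sum.cartesian_product' sc_elem_def grid_rank_def)
  finally show "sc (rows a b c d) = alt_sum c d - alt_sum a b"
    by (simp add: sum_negf sum_alternating)
qed

definition interior_odds :: "nat \<Rightarrow> nat set" where
  "interior_odds n = {x. 1 < x \<and> x < n \<and> odd x}"

lemma finite_interior_odds [simp]: "finite (interior_odds n)"
  by (rule finite_subset[of _ "{..n}"]) (auto simp: interior_odds_def)

text \<open>At most one summand is nonzero: a lower singleton at an interior odd position gains 1,
  an upper one loses 1. With this correction the sums over rounds telescope.\<close>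

definition corrected_sc :: "nat \<Rightarrow> (nat \<times> nat) set \<Rightarrow> int" where
  "corrected_sc n I = sc I + (\<Sum>x\<in>interior_odds n. of_bool (I = {(1, x)}) - of_bool (I = {(2, x)}))"

lemma rows_eq_bottom_singleton: "rows a b c d = {(1, x)} \<longleftrightarrow> a = x \<and> b = x \<and> d < c"
proof
  assume e: "rows a b c d = {(1, x)}"
  have 1: "a \<le> j \<and> j \<le> b \<longleftrightarrow> j = x" for j
    using mem_rows[of 1 j a b c d] unfolding e by simp
  have "\<not> (c \<le> j \<and> j \<le> d)" for j
    using mem_rows[of 2 j a b c d] unfolding e by simp
  from this[of c] 1[of a] 1[of b] 1[of x] show "a = x \<and> b = x \<and> d < c" by auto
qed (auto simp: rows_def)

lemma rows_eq_top_singleton: "rows a b c d = {(2, x)} \<longleftrightarrow> c = x \<and> d = x \<and> b < a"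
proof
  assume e: "rows a b c d = {(2, x)}"
  have 1: "c \<le> j \<and> j \<le> d \<longleftrightarrow> j = x" for j
    using mem_rows[of 2 j a b c d] unfolding e by simp
  have "\<not> (a \<le> j \<and> j \<le> b)" for j
    using mem_rows[of 1 j a b c d] unfolding e by simp
  from this[of a] 1[of c] 1[of d] 1[of x] show "c = x \<and> d = x \<and> b < a" by auto
qed (auto simp: rows_def)

lemma corrected_sc_bottom:
  assumes "1 \<le> a" "a \<le> b"
  shows "corrected_sc n (rows a b 1 0) = of_bool (a = b \<and> a \<in> interior_odds n) - alt_sum a b"
proof -
  have "(\<Sum>x\<in>interior_odds n. of_bool (rows a b 1 0 = {(1, x)}) - of_bool (rows a b 1 0 = {(2, x)}))
    = (\<Sum>x\<in>interior_odds n. if a = x then of_bool (a = b) else (0::int))"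
    using assms by (intro sum.cong) (auto simp: rows_eq_bottom_singleton rows_eq_top_singleton simp del: One_nat_def)
  then show ?thesis using assms by (simp add: corrected_sc_def sc_rows alt_sum_def del: One_nat_def)
qed

lemma corrected_sc_top:
  assumes "1 \<le> c" "c \<le> d"
  shows "corrected_sc n (rows 1 0 c d) = alt_sum c d - of_bool (c = d \<and> c \<in> interior_odds n)"
proof -
  have "(\<Sum>x\<in>interior_odds n. of_bool (rows 1 0 c d = {(1, x)}) - of_bool (rows 1 0 c d = {(2, x)}))
    = (\<Sum>x\<in>interior_odds n. if c = x then - of_bool (c = d) else (0::int))"
    using assms by (intro sum.cong) (auto simp: rows_eq_bottom_singleton rows_eq_top_singleton simp del: One_nat_def)
  then show ?thesis using assms by (simp add: corrected_sc_def sc_rows alt_sum_def del: One_nat_def)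
qed

lemma corrected_sc_both:
  assumes "1 \<le> a" "a \<le> b" "c \<le> d"
  shows "corrected_sc n (rows a b c d) = alt_sum c d - alt_sum a b"
proof -
  have "(\<Sum>x\<in>interior_odds n. of_bool (rows a b c d = {(1, x)}) - of_bool (rows a b c d = {(2, x)})) = (0::int)"
    using assms by (intro sum.neutral) (auto simp: rows_eq_bottom_singleton rows_eq_top_singleton simp del: One_nat_def)
  then show ?thesis using assms by (simp add: corrected_sc_def sc_rows)
qed

lemma funpow_add_apply: "(f ^^ (k + l)) x = (f ^^ l) ((f ^^ k) x)"
  by (simp add: funpow_add add.commute[of k l])

lemma sum_funpow_add:
  "(\<Sum>i<k+l. g ((f ^^ i) x)) = (\<Sum>i<k. g ((f ^^ i) x)) + (\<Sum>i<l. g ((f ^^ i) ((f ^^ k) x)))"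
  for g :: "'a \<Rightarrow> 'b :: comm_monoid_add"
  by (induction l) (simp_all add: funpow_add_apply[symmetric] add.assoc)

section \<open>The pieces of a round and the values they accumulate\<close>

context two_row
begin

text \<open>The final set \<open>J\<close> is not counted, so that values add when paths are
  concatenated. The condition \<open>k > 0\<close> ensures that repeated rounds become arbitrarily
  long and that \<open>J\<close> lies in the forward orbit of \<open>I\<close>.\<close>

definition reach :: "(nat \<times> nat) set \<Rightarrow> (nat \<times> nat) set \<Rightarrow> int \<Rightarrow> bool" where
  "reach I J v \<longleftrightarrow> (\<exists>k>0. (row ^^ k) I = J \<and> (\<Sum>i<k. corrected_sc n ((row ^^ i) I)) = v)"

lemma reach_step: "row I = J \<Longrightarrow> reach I J (corrected_sc n I)"
  unfolding reach_def by (rule exI[of _ 1]) simp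

lemma reach_trans:
  assumes "reach I J v" "reach J K w"
  shows "reach I K (v + w)"
proof -
  obtain k where k: "k > 0" "(row ^^ k) I = J" "(\<Sum>i<k. corrected_sc n ((row ^^ i) I)) = v"
    using assms(1) unfolding reach_def by blast
  obtain l where l: "l > 0" "(row ^^ l) J = K" "(\<Sum>i<l. corrected_sc n ((row ^^ i) J)) = w"
    using assms(2) unfolding reach_def by blast
  have "(row ^^ (k + l)) I = K"
    by (simp only: funpow_add_apply k(2) l(2))
  moreover have "(\<Sum>i<k+l. corrected_sc n ((row ^^ i) I)) = v + w"
    by (simp only: sum_funpow_add k(2,3) l(3))
  moreover have "0 < k + l" using k(1) by simp
  ultimately show ?thesis unfolding reach_def by blast
qed

lemma reach_Cons: "row I = J \<Longrightarrow> reach J K w \<Longrightarrow> reach I K (corrected_sc n I + w)"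
  using reach_step reach_trans by blast

lemma reach_cong: "reach I J v \<Longrightarrow> I = I' \<Longrightarrow> J = J' \<Longrightarrow> v = v' \<Longrightarrow> reach I' J' v'"
  by simp

text \<open>The path has \<open>z + 1\<close> steps. Each shift raises all bounds by one and thereby
  negates the value, so only the first value survives, and only if the number of steps is
  odd.\<close>

lemma reach_shift:
  assumes "1 \<le> c" "c \<le> a" "a < b" "b \<le> n" "n = b + z"
  shows "reach (rows (Suc a) b c a) (rows 1 0 (c+z+1) (a+z+1))
           (if even z then alt_sum c a - alt_sum (Suc a) b else 0)"
  using assms
proof (induction z arbitrary: a b c)
  case 0
  then have "row (rows (Suc a) b c a) = rows 1 0 (c+1) (a+1)" using row_shift_end[of c "Suc a"] by simp
  from 0 show ?case
    by (intro reach_cong[OF reach_step[OF \<open>row _ = _\<close>]]) (simp_all add: corrected_sc_both)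
next
  case (Suc z)
  then have r: "row (rows (Suc a) b c a) = rows (Suc (Suc a)) (Suc b) (Suc c) (Suc a)"
    using row_shift[of c "Suc a" b] by simp
  have IH: "reach (rows (Suc (Suc a)) (Suc b) (Suc c) (Suc a)) (rows 1 0 (Suc c+z+1) (Suc a+z+1))
      (if even z then alt_sum (Suc c) (Suc a) - alt_sum (Suc (Suc a)) (Suc b) else 0)"
    using Suc.prems by (intro Suc.IH) auto
  show ?case
    using Suc.prems
    by (intro reach_cong[OF reach_Cons[OF r IH]]) (simp_all add: corrected_sc_both alt_sum_Suc_Suc)
qed

text \<open>For odd \<open>z\<close> the climb contributes \<open>alt_sum 1 a + alt_sum a b\<close>,
  whose second term cancels the value of the initial set. For even \<open>z\<close> the climb
  contributes nothing.\<close>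

lemma reach_bottom_top:
  assumes "1 \<le> a" "a \<le> b" "n = b + z"
  shows "reach (rows a b 1 0) (rows 1 0 (z+1) (z+a))
    (of_bool (a = b \<and> a \<in> interior_odds n) + (if even z then - alt_sum a b else alt_sum 1 a))"
proof (cases z)
  case 0
  then have r: "row (rows a b 1 0) = rows 1 0 1 a" using row_bottom_end[of a] assms by simp
  show ?thesis
    using assms 0 by (intro reach_cong[OF reach_step[OF r]]) (simp_all add: corrected_sc_bottom del: One_nat_def)
next
  case (Suc y)
  have r: "row (rows a b 1 0) = rows (Suc a) (Suc b) 1 a"
    using row_bottom_start[of a b] assms Suc by simp
  have R: "reach (rows (Suc a) (Suc b) 1 a) (rows 1 0 (z+1) (z+a))
      (if even y then alt_sum 1 a - alt_sum (Suc a) (Suc b) else 0)"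
    by (rule reach_cong[OF reach_shift[of 1 a "Suc b" y]]) (use assms Suc in auto)
  show ?thesis
    using assms Suc
    by (intro reach_cong[OF reach_Cons[OF r R]]) (simp_all add: corrected_sc_bottom alt_sum_Suc_Suc del: One_nat_def)
qed

text \<open>The way back from an upper interval depends on the gap between its upper bound and
  \<open>n\<close>. The suffixes \<open>ge2\<close>, \<open>1\<close> and \<open>0\<close> of this
  and the next two lemmas give that gap.\<close>

lemma reach_top_bottom_ge2:
  assumes "1 \<le> c" "c \<le> d" "d + 2 \<le> n"
  shows "reach (rows 1 0 c d) (if d + 2 < n then rows (c+3) (d+3) 1 0 else rows 1 (c+1) 1 0)
    (alt_sum 1 (d+2) - alt_sum (c+1) n - alt_sum c d - of_bool (c = d \<and> c \<in> interior_odds n))"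
proof -
  have r1: "row (rows 1 0 c d) = rows (c+1) n (c+1) (d+1)" using row_top[of c d] assms by simp
  have r2: "row (rows (c+1) n (c+1) (d+1)) = rows (c+2) (d+2) 1 (d+2)"
    using row_mid[of "c+1" "d+1"] assms by simp
  have r3: "row (rows (c+2) (d+2) 1 (d+2)) = (if d + 2 < n then rows (c+3) (d+3) 1 0 else rows 1 (c+1) 1 0)"
    using row_prefix[of "c+2" "d+2"] row_prefix_end[of "c+2"] assms by (auto simp: numeral_eq_Suc)
  have "alt_sum (c+1) (d+1) = - alt_sum c d" "alt_sum (c+2) (d+2) = alt_sum c d"
    using alt_sum_Suc_Suc[of c d] alt_sum_Suc_Suc[of "Suc c" "Suc d"] by simp_all
  with assms show ?thesis
    by (intro reach_cong[OF reach_Cons[OF r1 reach_Cons[OF r2 reach_step[OF r3]]]])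
       (simp_all add: corrected_sc_top corrected_sc_both del: One_nat_def)
qed

lemma reach_top_bottom_1:
  assumes "1 \<le> c" "c \<le> d" "n = d + 1"
  shows "reach (rows 1 0 c d) (rows 2 (c+1) 1 0) (alt_sum c d - of_bool (c = d \<and> c \<in> interior_odds n))"
proof -
  have r1: "row (rows 1 0 c d) = rows (c+1) n (c+1) n" using row_top[of c d] assms by simp
  have r2: "row (rows (c+1) n (c+1) n) = rows 1 c 1 c" using row_mid_end[of "c+1"] assms by simp
  have r3: "row (rows 1 c 1 c) = rows 2 (c+1) 1 0"
    using row_prefix[of 1 c] assms by (simp add: numeral_2_eq_2)
  show ?thesis
    using assms
    by (intro reach_cong[OF reach_Cons[OF r1 reach_Cons[OF r2 reach_step[OF r3]]]])
       (simp_all add: corrected_sc_top corrected_sc_both del: One_nat_def)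
qed

lemma reach_top_bottom_0:
  assumes "1 \<le> c" "c < n"
  shows "reach (rows 1 0 (c+1) n) (if c + 1 < n then rows 3 (c+2) 1 0 else rows 1 1 1 0)
    (alt_sum (c+1) n + alt_sum 1 c - alt_sum 1 n + alt_sum 1 (c+1) - alt_sum 2 (c+1))"
proof -
  have r1: "row (rows 1 0 (c+1) n) = rows 1 n 1 c" using row_top_end[of "c+1"] assms by simp
  have r2: "row (rows 1 n 1 c) = rows 2 (c+1) 1 (c+1)" using row_mid_full[of c] assms by simp
  have r3: "row (rows 2 (c+1) 1 (c+1)) = (if c + 1 < n then rows 3 (c+2) 1 0 else rows 1 1 1 0)"
  proof (cases "c + 1 < n")
    case True
    then show ?thesis using row_prefix[of 2 "c+1"] assms by simp
  next
    case False
    then have "c + 1 = n" using assms by simp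
    then show ?thesis using row_prefix_end[of 2] assms by simp
  qed
  \<comment> \<open>For \<open>c + 1 = n\<close> the starting set is the upper singleton at
    \<open>n\<close>, which is not an interior position, so no correction appears.\<close>
  have "n \<notin> interior_odds n" by (simp add: interior_odds_def)
  with assms show ?thesis
    by (intro reach_cong[OF reach_Cons[OF r1 reach_Cons[OF r2 reach_step[OF r3]]]])
       (auto simp add: corrected_sc_top corrected_sc_both simp del: One_nat_def)
qed

lemma reach_top_bottom_full:
  assumes "1 \<le> n"
  shows "reach (rows 1 0 1 n) (rows 1 n 1 0) (alt_sum 1 n)"
  using assms
  by (intro reach_cong[OF reach_step[OF row_top_full]])
     (auto simp: corrected_sc_top interior_odds_def simp del: One_nat_def)

text \<open>The summand at \<open>a = 1\<close> marks the intervals whose round passes through an upper singleton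
  counted by \<open>corrected_sc\<close>.\<close>

definition potential :: "nat \<Rightarrow> nat \<Rightarrow> int" where
  "potential a b = (if odd a \<and> odd b then of_bool (a = 1 \<and> 1 < b \<and> b < n) else 1)"

text \<open>With \<open>z = n - b\<close> the upper interval in mid-round is
  \<open>[z+1, z+a]\<close>, so its gap to \<open>n\<close> is \<open>b - a\<close>, which selects
  the return lemma. It is a singleton exactly for \<open>a = 1\<close>. Since \<open>n\<close> is
  odd, \<open>z\<close> and \<open>b\<close> have opposite parity, and the values are compared by
  parity.\<close>

lemma reach_next_bottom:
  assumes n: "odd n" and ab: "1 \<le> a" "a \<le> b" "b \<le> n"
  shows "\<exists>a' b'. 1 \<le> a' \<and> a' \<le> b' \<and> b' \<le> n \<and> reach (rows a b 1 0) (rows a' b' 1 0) (potential a' b' - potential a b)"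
proof -
  obtain z where z: "n = b + z" using ab le_Suc_ex by blast
  have zb: "even z \<longleftrightarrow> odd b" using n z by simp
  have io: "x \<in> interior_odds n \<longleftrightarrow> 1 < x \<and> x < n \<and> odd x" for x by (simp add: interior_odds_def)
  note A = reach_bottom_top[OF ab(1,2) z]
  have fin: ?thesis
    if "reach (rows 1 0 (z+1) (z+a)) (rows a' b' 1 0) w" "1 \<le> a'" "a' \<le> b'" "b' \<le> n"
      "of_bool (a = b \<and> a \<in> interior_odds n) + (if even z then - alt_sum a b else alt_sum 1 a) + w = potential a' b' - potential a b"
    for a' b' w
    using reach_trans[OF A that(1)] that(2-) by (metis (no_types))
  consider "a + 2 < b" | "b = a + 2" | "b = a + 1" | "a = b" "0 < z" | "a = b" "z = 0"
    using ab by linarith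
  then show ?thesis
  proof cases
    case 1
    show ?thesis
    proof (rule fin)
      show "reach (rows 1 0 (z+1) (z+a)) (rows (z+4) (z+a+3) 1 0)
        (alt_sum 1 (z+a+2) - alt_sum (z+2) n - alt_sum (z+1) (z+a) - of_bool (a = 1 \<and> z+1 \<in> interior_odds n))"
        using 1 ab z
        by (intro reach_cong[OF reach_top_bottom_ge2[of "z+1" "z+a"]]) auto
      show "of_bool (a = b \<and> a \<in> interior_odds n) + (if even z then - alt_sum a b else alt_sum 1 a) +
         (alt_sum 1 (z+a+2) - alt_sum (z+2) n - alt_sum (z+1) (z+a) - of_bool (a = 1 \<and> z+1 \<in> interior_odds n))
         = potential (z+4) (z+a+3) - potential a b"
        unfolding alt_sum_def potential_def io using 1 ab z zb n
        by (cases "even a"; cases "even b") (simp_all, auto?)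
    qed (use 1 ab z in auto)
  next
    case 2
    show ?thesis
    proof (rule fin)
      show "reach (rows 1 0 (z+1) (z+a)) (rows 1 (z+2) 1 0)
        (alt_sum 1 (z+a+2) - alt_sum (z+2) n - alt_sum (z+1) (z+a) - of_bool (a = 1 \<and> z+1 \<in> interior_odds n))"
        using 2 ab z
        by (intro reach_cong[OF reach_top_bottom_ge2[of "z+1" "z+a"]]) auto
      show "of_bool (a = b \<and> a \<in> interior_odds n) + (if even z then - alt_sum a b else alt_sum 1 a) +
         (alt_sum 1 (z+a+2) - alt_sum (z+2) n - alt_sum (z+1) (z+a) - of_bool (a = 1 \<and> z+1 \<in> interior_odds n))
         = potential 1 (z+2) - potential a b"
        unfolding alt_sum_def potential_def io using 2 ab z zb n
        by (cases "even a") (simp_all, auto?)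
    qed (use 2 ab z in auto)
  next
    case 3
    show ?thesis
    proof (rule fin)
      show "reach (rows 1 0 (z+1) (z+a)) (rows 2 (z+2) 1 0)
        (alt_sum (z+1) (z+a) - of_bool (a = 1 \<and> z+1 \<in> interior_odds n))"
        using 3 ab z
        by (intro reach_cong[OF reach_top_bottom_1[of "z+1" "z+a"]]) auto
      show "of_bool (a = b \<and> a \<in> interior_odds n) + (if even z then - alt_sum a b else alt_sum 1 a) +
         (alt_sum (z+1) (z+a) - of_bool (a = 1 \<and> z+1 \<in> interior_odds n))
         = potential 2 (z+2) - potential a b"
        unfolding alt_sum_def potential_def io using 3 ab z zb n
        by (cases "even a") (simp_all, auto?)
    qed (use 3 ab z in auto)
  next
    case 4
    \<comment> \<open>The upper interval is \<open>[z+1, n]\<close>, so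
      \<open>reach_top_bottom_0\<close> is used with \<open>c = z\<close>.\<close>
    define w where "w = alt_sum (z+1) n + alt_sum 1 z - alt_sum 1 n + alt_sum 1 (z+1) - alt_sum 2 (z+1)"
    have R: "reach (rows 1 0 (z+1) (z+a)) (if z + 1 < n then rows 3 (z+2) 1 0 else rows 1 1 1 0) w"
      using reach_top_bottom_0[of z] 4 ab z by (simp add: w_def add.commute)
    have v: "of_bool (a = b \<and> a \<in> interior_odds n) + (if even z then - alt_sum a b else alt_sum 1 a) + w
       = (if z + 1 < n then potential 3 (z+2) else potential 1 1) - potential a b"
      unfolding w_def alt_sum_def potential_def io using 4 ab z zb n
      by (cases "even b") (simp_all, auto?)
    show ?thesis
    proof (cases "z + 1 < n")
      case True
      show ?thesis
        by (rule fin[OF R[unfolded if_P[OF True]] _ _ _ v[unfolded if_P[OF True]]]) (use True 4 in auto)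
    next
      case False
      show ?thesis
        by (rule fin[OF R[unfolded if_not_P[OF False]] _ _ _ v[unfolded if_not_P[OF False]]]) (use ab in auto)
    qed
  next
    case 5
    show ?thesis
    proof (rule fin)
      show "reach (rows 1 0 (z+1) (z+a)) (rows 1 n 1 0) (alt_sum 1 n)"
        using reach_top_bottom_full 5 ab z by simp
      show "of_bool (a = b \<and> a \<in> interior_odds n) + (if even z then - alt_sum a b else alt_sum 1 a) + alt_sum 1 n
         = potential 1 n - potential a b"
        unfolding alt_sum_def potential_def io using 5 ab n z by simp
    qed (use 5 ab z in auto)
  qed
qed

end

section \<open>Orbits\<close>

lemma self_in_orbit_if_inj_on:
  assumes "finite A" "f ` A \<subseteq> A" "inj_on f A" "x \<in> A"
  shows "x \<in> orbit f x"
proof -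
  \<comment> \<open>The identity outside \<open>A\<close> extends \<open>f\<close> to a permutation
    of the whole type, for which recurrence is known; the orbit of \<open>x\<close> never leaves
    \<open>A\<close> and is the same for \<open>f\<close> and \<open>g\<close>.\<close>
  define g where "g y = (if y \<in> A then f y else y)" for y
  have "bij_betw f A A"
    using assms(1-3) by (simp add: bij_betw_def endo_inj_surj)
  then have "bij_betw g A A"
    by (rule bij_betw_cong[THEN iffD1, rotated]) (simp add: g_def)
  then have "g permutes A"
    by (rule bij_imp_permutes) (simp add: g_def)
  then have "x \<in> orbit g x"
    using assms(1) by (intro permutation_self_in_orbit) (auto simp: permutation_permutes)
  also have "orbit g x = orbit f x"
    using assms(2,4) by (intro orbit_cong0[of x A]) (auto simp: g_def)
  finally show ?thesis .
qed

lemma sum_funpow_mult: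
  fixes g :: "'a \<Rightarrow> int"
  assumes "(f ^^ L) x = x"
  shows "(\<Sum>i<q * L. g ((f ^^ i) x)) = int q * (\<Sum>i<L. g ((f ^^ i) x))"
proof (induction q)
  case (Suc q)
  have "(f ^^ L) ((f ^^ (q * L)) x) = (f ^^ (q * L)) x" "(f ^^ (q * L)) x = x" for q
    by (induction q) (simp_all add: funpow_add_apply assms)
  have "(\<Sum>i<Suc q * L. g ((f ^^ i) x)) = (\<Sum>i<L + q * L. g ((f ^^ i) x))" by simp
  also have "\<dots> = (\<Sum>i<L. g ((f ^^ i) x)) + int q * (\<Sum>i<L. g ((f ^^ i) x))"
    by (simp only: sum_funpow_add assms Suc.IH)
  finally show ?case by (simp add: algebra_simps)
qed simp

text \<open>Over \<open>q\<close> periods the partial sum is \<open>q\<close> times the orbit sum,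
  up to a bounded remainder. If arbitrarily late partial sums stay bounded, the orbit sum must
  vanish; there is no need to know where the rounds close up.\<close>

lemma sum_orbit_eq_0:
  fixes g :: "'a \<Rightarrow> int"
  assumes x: "x \<in> orbit f x"
    and bnd: "\<And>m. \<exists>k\<ge>m. \<bar>\<Sum>i<k. g ((f ^^ i) x)\<bar> \<le> C"
  shows "(\<Sum>y\<in>orbit f x. g y) = 0"
proof -
  define L where "L = funpow_dist1 f x x"
  define T where "T = (\<Sum>i<L. g ((f ^^ i) x))"
  define D where "D = (\<Sum>i<L. \<bar>g ((f ^^ i) x)\<bar>)"
  have L: "L > 0" "(f ^^ L) x = x"
    unfolding L_def using funpow_dist1_prop[OF x] by auto
  have "(\<Sum>y\<in>orbit f x. g y) = T"
    unfolding orbit_conv_funpow_dist1[OF x] T_def L_def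
    by (subst sum.reindex[OF inj_on_funpow_dist1[OF x]]) (simp add: atLeast0LessThan)
  moreover have "T = 0"
  proof (rule ccontr)
    assume T: "T \<noteq> 0"
    have D: "\<bar>\<Sum>i<r. g ((f ^^ i) x)\<bar> \<le> D" if "r < L" for r
      unfolding D_def using that by (intro order_trans[OF sum_abs] sum_mono2) auto
    \<comment> \<open>This length forces at least \<open>C + D + 1\<close> full periods, more than a
      nonzero \<open>T\<close> allows.\<close>
    obtain k where k: "k \<ge> L * nat (C + D + 1)" "\<bar>\<Sum>i<k. g ((f ^^ i) x)\<bar> \<le> C"
      using bnd by blast
    define q r where "q = k div L" and "r = k mod L"
    have kqr: "k = q * L + r" "r < L" using L by (simp_all add: q_def r_def)
    have "(f ^^ (q * L)) x = x"
      using funpow_mod_eq[OF L(2), of "q * L"] by simp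
    then have "(\<Sum>i<k. g ((f ^^ i) x)) = int q * T + (\<Sum>i<r. g ((f ^^ i) x))"
      unfolding kqr(1) sum_funpow_add T_def by (simp only: sum_funpow_mult[OF L(2)])
    then have "\<bar>int q * T\<bar> \<le> C + D" using k(2) D[OF kqr(2)] by linarith
    moreover have "\<bar>int q * T\<bar> \<ge> int q" using mult_left_mono[of 1 "\<bar>T\<bar>" "int q"] T by (simp add: abs_mult)
    moreover have "int q \<ge> C + D + 1"
    proof -
      have "nat (C + D + 1) * L div L \<le> k div L"
        using k(1) by (intro div_le_mono) (simp add: mult.commute)
      then have "nat (C + D + 1) \<le> q" using L(1) by (simp add: q_def)
      then show ?thesis by linarith
    qed
    ultimately show False by linarith
  qed
  ultimately show ?thesis by simp
qed

section \<open>Reflection symmetry of the singleton counts\<close>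

lemma interior_odds_reflect: "odd n \<Longrightarrow> x \<in> interior_odds n \<Longrightarrow> n + 1 - x \<in> interior_odds n"
  by (auto simp: interior_odds_def)

text \<open>Here \<open>p x\<close> and \<open>m x\<close> say that the lower, respectively upper, singleton at \<open>x\<close> lies in the
  orbit. Exchanging \<open>p\<close> and \<open>m\<close> at odd positions makes both 3-periodic on \<open>{2..n-1}\<close>.\<close>

lemma balanced_sum:
  fixes p m :: "nat \<Rightarrow> bool"
  assumes n: "odd n" "n \<ge> 5"
    and mp: "\<And>x. 1 \<le> x \<Longrightarrow> x + 3 \<le> n \<Longrightarrow> m x \<longleftrightarrow> p (x + 3)"
    and pm: "\<And>x. 2 \<le> x \<Longrightarrow> x + 4 \<le> n \<Longrightarrow> p x \<longleftrightarrow> m (x + 3)"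
    and ends: "p (n - 3) \<longleftrightarrow> m 4" "p (n - 1) \<longleftrightarrow> p 3" "p n \<longleftrightarrow> m 1" "m (n - 2) \<longleftrightarrow> m 2"
  shows "(\<Sum>x\<in>interior_odds n. of_bool (m x) - of_bool (p x) :: int) = 0"
proof -
  define u where "u x = (if even x then p x else m x)" for x
  define v where "v x = (if even x then m x else p x)" for x
  have step: "u (x + 3) = u x" "v (x + 3) = v x" if "2 \<le> x" "x + 4 \<le> n" for x
    using mp[of x] pm[of x] that by (auto simp: u_def v_def)
  have per: "u (x + 3 * k) = u x \<and> v (x + 3 * k) = v x" if "2 \<le> x" "x + 3 * k + 1 \<le> n" for x k
    using that
  proof (induction k)
    case (Suc k)
    then show ?case using step[of "x + 3 * k"] by (simp add: add.assoc algebra_simps)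
  qed simp
  \<comment> \<open>The representatives are 2, 3, 4 instead of the residues 0, 1, 2, because the
    periodicity starts only at position 2.\<close>
  have cls: "u x = u r \<and> v x = v r" if x: "2 \<le> x" "x < n" and r: "x mod 3 = r mod 3" "r \<in> {2,3,4}" for x r
  proof -
    have "r = 2 \<or> r = 3 \<or> r = 4" using r(2) by simp
    then have "r \<le> x" "2 \<le> r" using x(1) r(1) by presburger+
    then obtain k where "x = r + 3 * k"
      using r(1) by (metis le_add_diff_inverse mod_eq_dvd_iff_nat dvdE)
    then show ?thesis using per[of r k] x \<open>2 \<le> r\<close> by auto
  qed
  have cls2: "u x = u 2" "v x = v 2" if "2 \<le> x" "x < n" "x mod 3 = 2" for x
    using cls[of x 2] that by simp_all
  have cls3: "u x = u 3" "v x = v 3" if "2 \<le> x" "x < n" "x mod 3 = 0" for x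
    using cls[of x 3] that by simp_all
  have cls4: "u x = u 4" "v x = v 4" if "2 \<le> x" "x < n" "x mod 3 = 1" for x
    using cls[of x 4] that by simp_all
  \<comment> \<open>These tie the upper end of the range to the lower end with \<open>u\<close> and
    \<open>v\<close> exchanged. The last one is the chain \<open>m (n - 3)\<close>,
    \<open>p n\<close>, \<open>m 1\<close>, \<open>p 4\<close>.\<close>
  have e: "u (n - 2) = v 2" "u (n - 1) = v 3" "u (n - 3) = v 4" "v (n - 3) = u 4"
    using n ends mp[of 1] mp[of "n - 3"] by (simp_all add: u_def v_def)
  define w where "w x = (of_bool (m x) - of_bool (p x) :: int)" for x
  \<comment> \<open>The residue of \<open>x\<close> modulo 3 fixes that of
    \<open>y = n + 1 - x\<close>. In each of the nine cases the relations \<open>e\<close>,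
    rewritten in the representatives 2, 3, 4, yield the sign change.\<close>
  have anti: "w (n + 1 - x) = - w x" if x: "x \<in> interior_odds n" for x
  proof -
    define y where "y = n + 1 - x"
    have xy: "2 \<le> x" "x < n" "2 \<le> y" "y < n" "odd x" "odd y" "x + y = n + 1"
      using x n by (auto simp: interior_odds_def y_def)
    have wuv: "w x = of_bool (u x) - of_bool (v x)" "w y = of_bool (u y) - of_bool (v y)"
      using xy by (simp_all add: w_def u_def v_def)
    obtain w' where w: "n = Suc (Suc (Suc w'))"
      using le_Suc_ex[OF n(2)] by (auto simp: numeral_eq_Suc)
    have n3: "n mod 3 = 0 \<or> n mod 3 = 1 \<or> n mod 3 = 2" by presburger
    have three: "k mod 3 = 0 \<or> k mod 3 = 1 \<or> k mod 3 = 2" for k :: nat by presburger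
    have sum3: "(x mod 3 + y mod 3) mod 3 = (n mod 3 + 1) mod 3"
      using mod_add_eq[of x 3 y] mod_add_left_eq[of n 3 1] xy(7) by argo
    from n3 have "w y = - w x"
    proof (elim disjE)
      assume nk: "n mod 3 = 0"
      then have m: "(n - 1) mod 3 = 2" "(n - 2) mod 3 = 1" "(n - 3) mod 3 = 0"
        by (auto simp: w mod_Suc split: if_splits)
      note ends' = cls4(1)[OF _ _ m(2)] cls2(1)[OF _ _ m(1)] cls3[OF _ _ m(3)]
      have "x mod 3 = 2 \<and> y mod 3 = 2 \<or> x mod 3 = 0 \<and> y mod 3 = 1 \<or> x mod 3 = 1 \<and> y mod 3 = 0"
        using nk sum3 three[of x] three[of y] by (elim disjE) simp_all
      then show ?thesis
      proof (elim disjE conjE)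
        assume "x mod 3 = 2" "y mod 3 = 2"
        from cls2[OF xy(1,2) this(1)] cls2[OF xy(3,4) this(2)] ends' e n(2)
        show ?thesis unfolding wuv by simp
      next
        assume "x mod 3 = 0" "y mod 3 = 1"
        from cls3[OF xy(1,2) this(1)] cls4[OF xy(3,4) this(2)] ends' e n(2)
        show ?thesis unfolding wuv by simp
      next
        assume "x mod 3 = 1" "y mod 3 = 0"
        from cls4[OF xy(1,2) this(1)] cls3[OF xy(3,4) this(2)] ends' e n(2)
        show ?thesis unfolding wuv by simp
      qed
    next
      assume nk: "n mod 3 = 1"
      then have m: "(n - 1) mod 3 = 0" "(n - 2) mod 3 = 2" "(n - 3) mod 3 = 1"
        by (auto simp: w mod_Suc split: if_splits)
      note ends' = cls2(1)[OF _ _ m(2)] cls3(1)[OF _ _ m(1)] cls4[OF _ _ m(3)]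
      have "x mod 3 = 2 \<and> y mod 3 = 0 \<or> x mod 3 = 0 \<and> y mod 3 = 2 \<or> x mod 3 = 1 \<and> y mod 3 = 1"
        using nk sum3 three[of x] three[of y] by (elim disjE) simp_all
      then show ?thesis
      proof (elim disjE conjE)
        assume "x mod 3 = 2" "y mod 3 = 0"
        from cls2[OF xy(1,2) this(1)] cls3[OF xy(3,4) this(2)] ends' e n(2)
        show ?thesis unfolding wuv by simp
      next
        assume "x mod 3 = 0" "y mod 3 = 2"
        from cls3[OF xy(1,2) this(1)] cls2[OF xy(3,4) this(2)] ends' e n(2)
        show ?thesis unfolding wuv by simp
      next
        assume "x mod 3 = 1" "y mod 3 = 1"
        from cls4[OF xy(1,2) this(1)] cls4[OF xy(3,4) this(2)] ends' e n(2)
        show ?thesis unfolding wuv by simp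
      qed
    next
      assume nk: "n mod 3 = 2"
      then have m: "(n - 1) mod 3 = 1" "(n - 2) mod 3 = 0" "(n - 3) mod 3 = 2"
        by (auto simp: w mod_Suc split: if_splits)
      note ends' = cls3(1)[OF _ _ m(2)] cls4(1)[OF _ _ m(1)] cls2[OF _ _ m(3)]
      have "x mod 3 = 2 \<and> y mod 3 = 1 \<or> x mod 3 = 0 \<and> y mod 3 = 0 \<or> x mod 3 = 1 \<and> y mod 3 = 2"
        using nk sum3 three[of x] three[of y] by (elim disjE) simp_all
      then show ?thesis
      proof (elim disjE conjE)
        assume "x mod 3 = 2" "y mod 3 = 1"
        from cls2[OF xy(1,2) this(1)] cls4[OF xy(3,4) this(2)] ends' e n(2)
        show ?thesis unfolding wuv by simp
      next
        assume "x mod 3 = 0" "y mod 3 = 0"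
        from cls3[OF xy(1,2) this(1)] cls3[OF xy(3,4) this(2)] ends' e n(2)
        show ?thesis unfolding wuv by simp
      next
        assume "x mod 3 = 1" "y mod 3 = 2"
        from cls4[OF xy(1,2) this(1)] cls2[OF xy(3,4) this(2)] ends' e n(2)
        show ?thesis unfolding wuv by simp
      qed
    qed
    then show ?thesis by (simp add: y_def)
  qed
  have "(\<Sum>x\<in>interior_odds n. w x) = (\<Sum>x\<in>interior_odds n. w (n + 1 - x))"
    by (rule sum.reindex_bij_witness[of _ "\<lambda>x. n + 1 - x" "\<lambda>x. n + 1 - x"])
       (use n(1) interior_odds_reflect in \<open>auto simp: interior_odds_def\<close>)
  also have "\<dots> = - (\<Sum>x\<in>interior_odds n. w x)"
    by (simp only: anti sum_negf cong: sum.cong)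
  finally show ?thesis by (simp add: w_def)
qed

lemma finite_IC: "finite P \<Longrightarrow> finite (IC P)"
  by (rule finite_subset[of _ "Pow P"]) (use IC_subset in auto)

lemma bottom_singleton: "{(1, x)} = rows x x 1 0" and top_singleton: "{(2, x)} = rows 1 0 x x"
  by (auto simp: rows_def)

section \<open>Sums over rowmotion orbits on two chains\<close>

context two_row
begin

lemma self_in_orbit: "I \<in> IC (two_by n) \<Longrightarrow> I \<in> orbit row I"
  by (rule self_in_orbit_if_inj_on[of "IC (two_by n)"])
     (auto simp: finite_IC two_by_def inj_on_rowmotion intro: rowmotion_in_IC)

text \<open>Orbits are cycles, so a path can also be followed backwards. The equivalence lets pieces
  of rounds be chained as statements about membership in one fixed orbit.\<close>

lemma reach_orbit:
  assumes "reach I J v" "I \<in> IC (two_by n)" "I0 \<in> IC (two_by n)"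
  shows "I \<in> orbit row I0 \<longleftrightarrow> J \<in> orbit row I0"
proof -
  obtain k where k: "0 < k" "J = (row ^^ k) I" using assms(1) unfolding reach_def by blast
  show ?thesis
  proof
    assume "I \<in> orbit row I0"
    then show "J \<in> orbit row I0" unfolding k(2) by (rule funpow_in_orbit)
  next
    assume J: "J \<in> orbit row I0"
    have "J \<in> orbit row I" using k by (auto simp: orbit_altdef)
    then have "I \<in> orbit row J" by (rule orbit_swap[OF self_in_orbit[OF assms(2)]])
    then show "I \<in> orbit row I0" using J by (rule orbit_trans)
  qed
qed

text \<open>Rounds are concatenated, the potential telescopes, and every round has at least one
  step.\<close>

lemma long_runs:
  assumes n: "odd n" and ab: "1 \<le> a" "a \<le> b" "b \<le> n"
  shows "\<exists>k\<ge>m. \<exists>a' b'. 1 \<le> a' \<and> a' \<le> b' \<and> b' \<le> n \<and> (row ^^ k) (rows a b 1 0) = rows a' b' 1 0 \<and>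
    (\<Sum>i<k. corrected_sc n ((row ^^ i) (rows a b 1 0))) = potential a' b' - potential a b"
proof (induction m)
  case 0
  show ?case by (rule exI[of _ 0]) (use ab in auto)
next
  case (Suc m)
  then obtain k a1 b1 where k: "k \<ge> m" "1 \<le> a1" "a1 \<le> b1" "b1 \<le> n"
    "(row ^^ k) (rows a b 1 0) = rows a1 b1 1 0"
    "(\<Sum>i<k. corrected_sc n ((row ^^ i) (rows a b 1 0))) = potential a1 b1 - potential a b" by blast
  from reach_next_bottom[OF n k(2-4)] obtain a2 b2 l where l: "1 \<le> a2" "a2 \<le> b2" "b2 \<le> n" "0 < l"
    "(row ^^ l) (rows a1 b1 1 0) = rows a2 b2 1 0"
    "(\<Sum>i<l. corrected_sc n ((row ^^ i) (rows a1 b1 1 0))) = potential a2 b2 - potential a1 b1"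
    unfolding reach_def by blast
  have "(row ^^ (k + l)) (rows a b 1 0) = rows a2 b2 1 0"
    by (simp only: funpow_add_apply k(5) l(5))
  moreover have "(\<Sum>i<k+l. corrected_sc n ((row ^^ i) (rows a b 1 0))) = potential a2 b2 - potential a b"
    by (simp only: sum_funpow_add k(5,6) l(6))
  moreover have "Suc m \<le> k + l" using k(1) l(4) by simp
  ultimately show ?case using l(1-3) by blast
qed

text \<open>The potential only takes the values 0 and 1, so the sums from \<open>long_runs\<close>
  are bounded by 1 and \<open>sum_orbit_eq_0\<close> applies.\<close>

lemma sum_corrected_sc_orbit:
  assumes "odd n" "1 \<le> a" "a \<le> b" "b \<le> n"
  shows "(\<Sum>I\<in>orbit row (rows a b 1 0). corrected_sc n I) = 0"
proof (rule sum_orbit_eq_0)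
  show "rows a b 1 0 \<in> orbit row (rows a b 1 0)"
    by (intro self_in_orbit rows_in_IC) (use assms in auto)
  have "0 \<le> potential a' b' \<and> potential a' b' \<le> 1" for a' b' by (simp add: potential_def)
  then have "\<bar>potential a' b' - potential a b\<bar> \<le> 1" for a' b'
    by (smt (verit))
  with long_runs[OF assms] show "\<exists>k\<ge>m. \<bar>\<Sum>i<k. corrected_sc n ((row ^^ i) (rows a b 1 0))\<bar> \<le> 1" for m
    by metis
qed

lemma singletons_balanced:
  assumes n: "odd n" "n \<ge> 5" and I0: "I0 \<in> IC (two_by n)"
  shows "(\<Sum>x\<in>interior_odds n. of_bool ({(2, x)} \<in> orbit row I0) - of_bool ({(1, x)} \<in> orbit row I0) :: int) = 0"
proof (rule balanced_sum[OF n])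
  let ?O = "orbit row I0"
  \<comment> \<open>The bounds \<open>c = n - b + 1\<close> and \<open>d = n - b + a\<close> are
    stated as equations between sums to avoid truncated subtraction.\<close>
  have A: "rows a b 1 0 \<in> ?O \<longleftrightarrow> rows 1 0 c d \<in> ?O"
    if "1 \<le> a" "a \<le> b" "b \<le> n" "c + b = n + 1" "d + b = n + a" for a b c d
  proof -
    obtain z where z: "n = b + z" using \<open>b \<le> n\<close> le_Suc_ex by blast
    with that have "c = z + 1" "d = z + a" by auto
    with reach_bottom_top[OF that(1,2) z] that show ?thesis
      by (intro reach_orbit[OF _ _ I0] rows_in_IC) auto
  qed
  have B: "rows 1 0 c d \<in> ?O \<longleftrightarrow> rows c' d' 1 0 \<in> ?O"
    if "1 \<le> c" "c \<le> d" "d + 2 < n" "c' = c + 3" "d' = d + 3" for c d c' d'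
    using reach_top_bottom_ge2[of c d] that by (intro reach_orbit[OF _ _ I0] rows_in_IC) auto
  have B2: "rows 1 0 c d \<in> ?O \<longleftrightarrow> rows 1 b 1 0 \<in> ?O"
    if "1 \<le> c" "c \<le> d" "d + 2 = n" "b = c + 1" for b c d
    using reach_top_bottom_ge2[of c d] that by (intro reach_orbit[OF _ _ I0] rows_in_IC) auto
  have B0: "rows 1 0 c n \<in> ?O \<longleftrightarrow> rows 3 b 1 0 \<in> ?O"
    if "2 \<le> c" "c < n" "b = c + 1" for b c
  proof -
    have "1 \<le> c - 1" "c - 1 < n" using that by auto
    from reach_top_bottom_0[OF this] that show ?thesis
      by (intro reach_orbit[OF _ _ I0] rows_in_IC) auto
  qed
  have F: "rows 1 0 1 n \<in> ?O \<longleftrightarrow> rows 1 n 1 0 \<in> ?O"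
    using reach_top_bottom_full n by (intro reach_orbit[OF _ _ I0] rows_in_IC) auto
  \<comment> \<open>A round and a half from a lower singleton: \<open>[x,x]_1\<close>,
    \<open>[n-x+1,n]_2\<close>, \<open>[3,n-x+2]_1\<close>, \<open>[x-1,x+1]_2\<close>. How it
    continues depends on the gap between \<open>x + 1\<close> and \<open>n\<close>.\<close>
  have half: "rows x x 1 0 \<in> ?O \<longleftrightarrow> rows 1 0 (x-1) (x+1) \<in> ?O" if x: "2 \<le> x" "x < n" for x
  proof -
    have "rows x x 1 0 \<in> ?O \<longleftrightarrow> rows 1 0 (n-x+1) n \<in> ?O"
      by (rule A) (use x in auto)
    also have "\<dots> \<longleftrightarrow> rows 3 (n-x+2) 1 0 \<in> ?O"
      by (rule B0) (use x in auto)
    also have "\<dots> \<longleftrightarrow> rows 1 0 (x-1) (x+1) \<in> ?O"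
      by (rule A) (use x in auto)
    finally show ?thesis .
  qed
  note single = bottom_singleton top_singleton
  show "{(2, x)} \<in> ?O \<longleftrightarrow> {(1, x+3)} \<in> ?O" if "1 \<le> x" "x + 3 \<le> n" for x
    unfolding single by (rule B) (use that in auto)
  show "{(1, x)} \<in> ?O \<longleftrightarrow> {(2, x+3)} \<in> ?O" if x: "2 \<le> x" "x + 4 \<le> n" for x
  proof -
    have "rows x x 1 0 \<in> ?O \<longleftrightarrow> rows 1 0 (x-1) (x+1) \<in> ?O"
      by (rule half) (use x in auto)
    also have "\<dots> \<longleftrightarrow> rows (x+2) (x+4) 1 0 \<in> ?O"
      by (rule B) (use x in auto)
    also have "\<dots> \<longleftrightarrow> rows 1 0 (n-x-3) (n-2) \<in> ?O"
      by (rule A) (use x in auto)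
    also have "\<dots> \<longleftrightarrow> rows 1 (n-x-2) 1 0 \<in> ?O"
      by (rule B2) (use x in auto)
    also have "\<dots> \<longleftrightarrow> rows 1 0 (x+3) (x+3) \<in> ?O"
      by (rule A) (use x in auto)
    finally show ?thesis unfolding single .
  qed
  \<comment> \<open>Here the upper interval from \<open>half\<close> ends at \<open>n - 2\<close>,
    so \<open>B2\<close> takes the place of \<open>B\<close>.\<close>
  show "{(1, n-3)} \<in> ?O \<longleftrightarrow> {(2, 4)} \<in> ?O"
  proof -
    have "rows (n-3) (n-3) 1 0 \<in> ?O \<longleftrightarrow> rows 1 0 (n-3-1) (n-3+1) \<in> ?O"
      by (rule half) (use n in auto)
    also have "\<dots> \<longleftrightarrow> rows 1 (n-3) 1 0 \<in> ?O"
      by (rule B2) (use n in auto)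
    also have "\<dots> \<longleftrightarrow> rows 1 0 4 4 \<in> ?O"
      by (rule A) (use n in auto)
    finally show ?thesis unfolding single .
  qed
  show "{(1, n-1)} \<in> ?O \<longleftrightarrow> {(1, 3)} \<in> ?O"
  proof -
    have "rows (n-1) (n-1) 1 0 \<in> ?O \<longleftrightarrow> rows 1 0 2 n \<in> ?O"
      by (rule A) (use n in auto)
    also have "\<dots> \<longleftrightarrow> rows 3 3 1 0 \<in> ?O"
      by (rule B0) (use n in auto)
    finally show ?thesis unfolding single .
  qed
  show "{(1, n)} \<in> ?O \<longleftrightarrow> {(2, 1)} \<in> ?O"
  proof -
    have "rows n n 1 0 \<in> ?O \<longleftrightarrow> rows 1 0 1 n \<in> ?O"
      by (rule A) (use n in auto)
    also have "\<dots> \<longleftrightarrow> rows 1 n 1 0 \<in> ?O"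
      by (rule F)
    also have "\<dots> \<longleftrightarrow> rows 1 0 1 1 \<in> ?O"
      by (rule A) (use n in auto)
    finally show ?thesis unfolding single .
  qed
  show "{(2, n-2)} \<in> ?O \<longleftrightarrow> {(2, 2)} \<in> ?O"
  proof -
    have "rows 1 0 (n-2) (n-2) \<in> ?O \<longleftrightarrow> rows 1 (n-1) 1 0 \<in> ?O"
      by (rule B2) (use n in auto)
    also have "\<dots> \<longleftrightarrow> rows 1 0 2 2 \<in> ?O"
      by (rule A) (use n in auto)
    finally show ?thesis unfolding single .
  qed
qed

lemma sum_sc_orbit:
  assumes n: "odd n" and x: "1 \<le> x" "x \<le> n"
  shows "(\<Sum>I\<in>orbit row {(1, x)}. sc I) = 0"
proof -
  let ?O = "orbit row {(1, x)}"
  have IC: "{(1, x)} \<in> IC (two_by n)"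
    unfolding bottom_singleton by (rule rows_in_IC) (use x in auto)
  have fin: "finite ?O" by (rule finite_orbit[OF self_in_orbit[OF IC]])
  have bal: "(\<Sum>y\<in>interior_odds n. of_bool ({(2, y)} \<in> ?O) - of_bool ({(1, y)} \<in> ?O) :: int) = 0"
  proof (cases "n \<ge> 5")
    case True
    then show ?thesis using singletons_balanced[OF n _ IC] by blast
  next
    case False
    then have "n = 1 \<or> n = 3" using n x by (auto, presburger)
    then have "interior_odds n = {}" by (auto simp: interior_odds_def le_Suc_eq numeral_eq_Suc less_Suc_eq)
    then show ?thesis by simp
  qed
  \<comment> \<open>The orbit is a set, so each singleton is counted at most once. Exchanging the
    two sums then turns the total correction into the difference of singleton counts in
    \<open>bal\<close>.\<close>
  have ind: "(\<Sum>I\<in>?O. of_bool (I = J)) = (of_bool (J \<in> ?O) :: int)" for J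
    unfolding of_bool_def by (rule sum.delta[OF fin])
  have "0 = (\<Sum>I\<in>?O. corrected_sc n I)"
    using sum_corrected_sc_orbit[of x x] n x unfolding bottom_singleton by simp
  also have "\<dots> = (\<Sum>I\<in>?O. sc I) +
      (\<Sum>I\<in>?O. \<Sum>y\<in>interior_odds n. of_bool (I = {(1, y)}) - of_bool (I = {(2, y)}))"
    unfolding corrected_sc_def by (rule sum.distrib)
  also have "(\<Sum>I\<in>?O. \<Sum>y\<in>interior_odds n. of_bool (I = {(1, y)}) - of_bool (I = {(2, y)}) :: int)
      = (\<Sum>y\<in>interior_odds n. \<Sum>I\<in>?O. of_bool (I = {(1, y)}) - of_bool (I = {(2, y)}))"
    by (rule sum.swap)
  also have "\<dots> = (\<Sum>y\<in>interior_odds n. of_bool ({(1, y)} \<in> ?O) - of_bool ({(2, y)} \<in> ?O))"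
    by (simp only: sum_subtractf ind)
  also have "\<dots> = - (\<Sum>y\<in>interior_odds n. of_bool ({(2, y)} \<in> ?O) - of_bool ({(1, y)} \<in> ?O))"
    by (simp add: sum_subtractf)
  finally show ?thesis unfolding bal by simp
qed

end

theorem theorem3p27:
  fixes n x :: nat
    and xs :: "(nat \<times> nat) list"
    and \<O> :: "(nat \<times> nat) set set"
  assumes "odd n"
    and "linear_extension (two_by n) xs"
    and "\<O> \<in> rowmotion_orbits (two_by n) xs"
    and "1 \<le> x" and "x \<le> n"
    and "{(1, x)} \<in> \<O>"
  shows "1 / real (card \<O>) * (\<Sum>I\<in>\<O>. real_of_int (sc I)) = 0"
proof -
  interpret two_row n xs by unfold_locales (rule assms(2))
  obtain I0 where I0: "I0 \<in> IC (two_by n)" "\<O> = orbit row I0"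
    using assms(3) unfolding rowmotion_orbits_def by blast
  have x: "{(1, x)} \<in> orbit row I0" using assms(6) I0(2) by simp
  \<comment> \<open>The orbit may be given by any starting set; recurrence makes the singleton an
    equally good one.\<close>
  have "I0 \<in> orbit row {(1, x)}" by (rule orbit_swap[OF self_in_orbit[OF I0(1)] x])
  with x have "\<O> = orbit row {(1, x)}" unfolding I0(2) by (blast intro: orbit_trans)
  then have "(\<Sum>I\<in>\<O>. sc I) = 0" using sum_sc_orbit[OF assms(1,4,5)] by simp
  then have "(\<Sum>I\<in>\<O>. real_of_int (sc I)) = 0" by (simp flip: of_int_sum)
  then show ?thesis by simp
qed

end
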